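(* Consider a power network with ZIP loads as described in the context, with buses $1,\dots,M$ being PQ buses, buses $M+1,\dots,N-1$ PV buses and bus $N$ the reference bus. For every order $k\ge1$, the order-$k$ differential transformation of the full nonlinear power flow system $0=g(y(t),\lambda(t))$ consisting of the equations (Z1)--(Z5) of the context satisfies (takes the form of) the formally linear equation $$0=\mathbf{A}_{gy}\mathbf{Y}(k)+\mathbf{A}_{g\lambda}\Lambda(k)+\mathbf{B}_g,\qquad \mathbf{Y}(k)=[E_1(k),F_1(k),\dots,E_N(k),F_N(k)]^T,$$ in which the matrices depend only on the power series coefficients of orders $0$ to $k-1$ of $y$ and $\lambda$ (and on the network data), and are given by $$\mathbf{A}_{gy}=\begin{bmatrix}\mathbf{A}_{y,PQ}\\ \mathbf{A}_{y,PV}\\ \mathbf{A}_{y,REF}\end{bmatrix},\quad \mathbf{A}_{g\lambda}=\begin{bmatrix}\mathbf{A}_{\lambda,PQ}\\ \mathbf{A}_{\lambda,PV}\\ \mathbf{A}_{\lambda,REF}\end{bmatrix},\quad \mathbf{B}_g=\begin{bmatrix}\mathbf{B}_{PQ}\\ \mathbf{B}_{PV}\\ \mathbf{B}_{REF}\end{bmatrix},$$ $$\mathbf{A}_{y,PQ}=\begin{bmatrix}\bar{\mathbf{a}}_{P,1}\\ \bar{\mathbf{a}}_{Q,1}\\ \vdots\\ \bar{\mathbf{a}}_{P,M}\\ \bar{\mathbf{a}}_{Q,M}\end{bmatrix},\quad \mathbf{A}_{\lambda,PQ}=-\begin{bmatrix}\Delta p_1\\ \Delta q_1\\ \vdots\\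 \Delta p_M\\ \Delta q_M\end{bmatrix},\quad \mathbf{B}_{PQ}=\begin{bmatrix}\bar\varepsilon_1\\ \bar\mu_1\\ \vdots\\ \bar\varepsilon_M\\ \bar\mu_M\end{bmatrix},$$ $$\mathbf{A}_{y,PV}=\begin{bmatrix}\mathbf{a}_{P,M+1}\\ \mathbf{a}_{V,M+1}\\ \vdots\\ \mathbf{a}_{P,N-1}\\ \mathbf{a}_{V,N-1}\end{bmatrix},\quad \mathbf{A}_{\lambda,PV}=-\begin{bmatrix}\Delta p_{M+1}\\ 0\\ \vdots\\ \Delta p_{N-1}\\ 0\end{bmatrix},\quad \mathbf{B}_{PV}=\begin{bmatrix}\varepsilon_{M+1}\\ \varsigma_{M+1}\\ \vdots\\ \varepsilon_{N-1}\\ \varsigma_{N-1}\end{bmatrix},$$ $$\mathbf{A}_{y,REF}=\begin{bmatrix}\mathbf{a}_{E,N}\\ \mathbf{a}_{F,N}\end{bmatrix},\quad \mathbf{A}_{\lambda,REF}=\begin{bmatrix}0\\0\end{bmatrix},\quad \mathbf{B}_{REF}=\begin{bmatrix}-e_N^{sp}\rho(k)\\ -f_N^{sp}\rho(k)\end{bmatrix},$$ with the row vectors and scalars appearing here defined in the context.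
   Context: Differential transformation (DT): for a real function $x(t)$, infinitely differentiable near $t=0$, its DT is $X(k)=\frac{1}{k!}\frac{d^kx}{dt^k}(0)$, $k\ge0$; the order-$k$ DT of an equation between such functions is the equation between the order-$k$ coefficients of both sides (the DT of a product $xy$ is $X(k)\otimes Y(k)=\sum_{m=0}^kX(m)Y(k-m)$). $\rho(0)=1$ and $\rho(k)=0$ for $k\ge1$ (DT of the constant $1$). Empty sums are $0$. Network: $N$ buses; $\Omega_{PQ}=\{1,\dots,M\}$, $\Omega_{PV}=\{M+1,\dots,N-1\}$, $\Omega_{REF}=\{N\}$. Real numbers $g_{ij},b_{ij}$ are the real and imaginary parts of the entries of the bus admittance matrix; $e_i(t),f_i(t)$ are the real and imaginary parts of the voltage phasor of bus $i$, collected in $y(t)$; $\lambda(t)$ is the loading parameter; their DTs are $E_i(k),F_i(k),\Lambda(k)$. $\Delta p_i,\Delta q_i,p_i^{sp},q_i^{sp},v_i^{sp},e_i^{sp},f_i^{sp}$ are given real constants. For ZIP loads: complex constants $z_i^{sp}\neq0$, $i_i^{sp}$, and real weights with $\alpha_{i,Z}+\alpha_{i,I}+\alpha_{i,P}=1$, $\beta_{i,Z}+\beta_{i,I}+\beta_{i,P}=1$. ZIP power injections: $p_{i,ZIP}=\alpha_{i,Z}\frac{\mathrm{Re}(z_i^{sp})}{|z_i^{sp}|^2}(e_i^2+f_i^2)+\alpha_{i,I}[e_i\mathrm{Re}(i_i^{sp})+f_i\mathrm{Im}(i_i^{sp})]+\alpha_{i,P}p_i^{sp}$, $q_{i,ZIP}=\beta_{i,Z}\frac{\mathrm{Im}(z_i^{sp})}{|z_i^{sp}|^2}(e_i^2+f_i^2)+\beta_{i,I}[f_i\mathrm{Re}(i_i^{sp})-e_i\mathrm{Im}(i_i^{sp})]+\beta_{i,P}q_i^{sp}$.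 Power flow equations with ZIP loads (sums over $j=1,\dots,N$): (Z1) $p_i^{sp}=-\lambda\Delta p_i+\sum_j g_{ij}(e_ie_j+f_if_j)+\sum_j b_{ij}(f_ie_j-e_if_j)$, $i\in\Omega_{PV}$; (Z2) $p_{i,ZIP}=-\lambda\Delta p_i+\sum_j g_{ij}(e_ie_j+f_if_j)+\sum_j b_{ij}(f_ie_j-e_if_j)$, $i\in\Omega_{PQ}$; (Z3) $q_{i,ZIP}=-\lambda\Delta q_i-\sum_j b_{ij}(e_ie_j+f_if_j)+\sum_j g_{ij}(f_ie_j-e_if_j)$, $i\in\Omega_{PQ}$; (Z4) $(v_i^{sp})^2=e_i^2+f_i^2$, $i\in\Omega_{PV}$; (Z5) $e_i^{sp}=e_i$ and $f_i^{sp}=f_i$, $i\in\Omega_{REF}$. Coefficients (row vectors in $\mathbb{R}^{1\times2N}$, columns ordered as in $\mathbf{Y}(k)$): $\mathbf{a}_{P,i}=[\alpha_{i1},\beta_{i1},\dots,\alpha_{iN},\beta_{iN}]$ with, for $j\ne i$, $\alpha_{ij}=g_{ij}E_i(0)+b_{ij}F_i(0)$, $\beta_{ij}=g_{ij}F_i(0)-b_{ij}E_i(0)$, and $\alpha_{ii}=\sum_{j=1}^N(g_{ij}E_j(0)-b_{ij}F_j(0))+g_{ii}E_i(0)+b_{ii}F_i(0)$, $\beta_{ii}=\sum_{j=1}^N(b_{ij}E_j(0)+g_{ij}F_j(0))-b_{ii}E_i(0)+g_{ii}F_i(0)$. $\mathbf{a}_{Q,i}=[\phi_{i1},\psi_{i1},\dots,\phi_{iN},\psi_{iN}]$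 with, for $j\ne i$, $\phi_{ij}=-b_{ij}E_i(0)+g_{ij}F_i(0)$, $\psi_{ij}=-b_{ij}F_i(0)-g_{ij}E_i(0)$, and $\phi_{ii}=-\sum_{j=1}^N(b_{ij}E_j(0)+g_{ij}F_j(0))-b_{ii}E_i(0)+g_{ii}F_i(0)$, $\psi_{ii}=\sum_{j=1}^N(g_{ij}E_j(0)-b_{ij}F_j(0))-g_{ii}E_i(0)-b_{ii}F_i(0)$. $\mathbf{a}_{V,i}$ has entries $2E_i(0)$, $2F_i(0)$ in the positions of $E_i(k)$, $F_i(k)$ and zeros elsewhere; $\mathbf{a}_{E,i}$ (resp. $\mathbf{a}_{F,i}$) has entry $1$ in the position of $E_i(k)$ (resp. $F_i(k)$) and zeros elsewhere. With $c_{ij}=\sum_{m=1}^{k-1}E_i(m)E_j(k-m)+\sum_{m=1}^{k-1}F_i(m)F_j(k-m)$ and $d_{ij}=\sum_{m=1}^{k-1}F_i(m)E_j(k-m)-\sum_{m=1}^{k-1}E_i(m)F_j(k-m)$: $\varepsilon_i=\sum_j g_{ij}c_{ij}+\sum_j b_{ij}d_{ij}-p_i^{sp}\rho(k)$, $\mu_i=-\sum_j b_{ij}c_{ij}+\sum_j g_{ij}d_{ij}-q_i^{sp}\rho(k)$, $\varsigma_i=c_{ii}-(v_i^{sp})^2\rho(k)$. $\mathbf{a}_{ZIP,i}$ has entries $\tau_{1,i},\tau_{2,i}$ and $\mathbf{c}_{ZIP,i}$ has entries $\tau_{3,i},\tau_{4,i}$ in the positions of $E_i(k),F_i(k)$,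 zeros elsewhere, where $\tau_{1,i}=\alpha_{i,Z}\frac{2E_i(0)\mathrm{Re}(z_i^{sp})}{|z_i^{sp}|^2}+\alpha_{i,I}\mathrm{Re}(i_i^{sp})$, $\tau_{2,i}=\alpha_{i,Z}\frac{2F_i(0)\mathrm{Re}(z_i^{sp})}{|z_i^{sp}|^2}+\alpha_{i,I}\mathrm{Im}(i_i^{sp})$, $\tau_{3,i}=\beta_{i,Z}\frac{2E_i(0)\mathrm{Im}(z_i^{sp})}{|z_i^{sp}|^2}-\beta_{i,I}\mathrm{Im}(i_i^{sp})$, $\tau_{4,i}=\beta_{i,Z}\frac{2F_i(0)\mathrm{Im}(z_i^{sp})}{|z_i^{sp}|^2}+\beta_{i,I}\mathrm{Re}(i_i^{sp})$; $b_{ZIP,i}=\alpha_{i,Z}\frac{\mathrm{Re}(z_i^{sp})}{|z_i^{sp}|^2}c_{ii}+\alpha_{i,P}p_i^{sp}\rho(k)$, $d_{ZIP,i}=\beta_{i,Z}\frac{\mathrm{Im}(z_i^{sp})}{|z_i^{sp}|^2}c_{ii}+\beta_{i,P}q_i^{sp}\rho(k)$. Finally, for $i\in\Omega_{PQ}$: $\bar{\mathbf{a}}_{P,i}=\mathbf{a}_{P,i}-\mathbf{a}_{ZIP,i}$, $\bar\varepsilon_i=\varepsilon_i+p_i^{sp}\rho(k)-b_{ZIP,i}$, $\bar{\mathbf{a}}_{Q,i}=\mathbf{a}_{Q,i}-\mathbf{c}_{ZIP,i}$, $\bar\mu_i=\mu_i+q_i^{sp}\rho(k)-d_{ZIP,i}$.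 *)

theory Defs
  imports "HOL-Analysis.Derivative" "Jordan_Normal_Form.Matrix"
begin

section \<open>Differential transformation\<close>

text \<open>The radius of the neighbourhood does not depend on the order of differentiation.\<close>

definition smooth_near_0 :: "(real \<Rightarrow> real) \<Rightarrow> bool" where
  "smooth_near_0 x \<longleftrightarrow>
     (\<exists>r>0. \<forall>n. \<forall>t. \<bar>t\<bar> < r \<longrightarrow> (deriv ^^ n) x differentiable (at t))"

definition DT :: "(real \<Rightarrow> real) \<Rightarrow> nat \<Rightarrow> real" where
  "DT x k = (deriv ^^ k) x 0 / fact k"

definition rho :: "nat \<Rightarrow> real" where
  "rho k = (if k = 0 then 1 else 0)"

text \<open>An equation between functions of \<open>t\<close> is the pair (left-hand side, right-hand side).\<close>

type_synonym equation = "(real \<Rightarrow> real) \<times> (real \<Rightarrow> real)"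

definition holds_at :: "equation \<Rightarrow> real \<Rightarrow> bool" where
  "holds_at q t \<longleftrightarrow> fst q t = snd q t"

definition holds_DT :: "equation \<Rightarrow> nat \<Rightarrow> bool" where
  "holds_DT q k \<longleftrightarrow> DT (fst q) k = DT (snd q) k"

text \<open>Right-hand side minus left-hand side: this sign makes the equation read \<open>0 = g\<close> with
  \<open>\<lambda> \<Delta>p\<close> and \<open>\<lambda> \<Delta>q\<close> entering \<open>g\<close> negatively.\<close>

definition residual :: "equation \<Rightarrow> real \<Rightarrow> real" where
  "residual q t = snd q t - fst q t"

section \<open>Network data\<close>

text \<open>Buses are numbered \<open>1, \<dots>, nbus\<close>: PQ buses \<open>1, \<dots>, npq\<close>, PV buses
  \<open>npq + 1, \<dots>, nbus - 1\<close>, reference bus \<open>nbus\<close>.\<close>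

record zip_network =
  nbus :: nat
  npq :: nat
  Ybus :: "nat \<Rightarrow> nat \<Rightarrow> complex"
  dp :: "nat \<Rightarrow> real"
  dq :: "nat \<Rightarrow> real"
  p_sp :: "nat \<Rightarrow> real"
  q_sp :: "nat \<Rightarrow> real"
  v_sp :: "nat \<Rightarrow> real"
  e_sp :: "nat \<Rightarrow> real"
  f_sp :: "nat \<Rightarrow> real"
  z_sp :: "nat \<Rightarrow> complex"
  i_sp :: "nat \<Rightarrow> complex"
  alphaZ :: "nat \<Rightarrow> real"
  alphaI :: "nat \<Rightarrow> real"
  alphaP :: "nat \<Rightarrow> real"
  betaZ :: "nat \<Rightarrow> real"
  betaI :: "nat \<Rightarrow> real"
  betaP :: "nat \<Rightarrow> real"

definition PQ_buses :: "zip_network \<Rightarrow> nat list" where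
  "PQ_buses net = [1..<npq net + 1]"

definition PV_buses :: "zip_network \<Rightarrow> nat list" where
  "PV_buses net = [npq net + 1..<nbus net]"

definition all_buses :: "zip_network \<Rightarrow> nat list" where
  "all_buses net = [1..<nbus net + 1]"

definition gY :: "zip_network \<Rightarrow> nat \<Rightarrow> nat \<Rightarrow> real" where
  "gY net i j = Re (Ybus net i j)"

definition bY :: "zip_network \<Rightarrow> nat \<Rightarrow> nat \<Rightarrow> real" where
  "bY net i j = Im (Ybus net i j)"

text \<open>\<open>interleave [i\<^sub>1, i\<^sub>2, \<dots>] a b = [a i\<^sub>1, b i\<^sub>1, a i\<^sub>2, b i\<^sub>2, \<dots>]\<close>.\<close>

definition interleave :: "nat list \<Rightarrow> (nat \<Rightarrow> 'a) \<Rightarrow> (nat \<Rightarrow> 'a) \<Rightarrow> 'a list" where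
  "interleave is a b = concat (map (\<lambda>i. [a i, b i]) is)"

section \<open>Power flow equations with ZIP loads\<close>

text \<open>In this section \<open>x j\<close> and \<open>y j\<close> are the real and imaginary parts of the voltage of
  bus \<open>j\<close> at a fixed time.\<close>

definition p_flow :: "zip_network \<Rightarrow> (nat \<Rightarrow> real) \<Rightarrow> (nat \<Rightarrow> real) \<Rightarrow> nat \<Rightarrow> real" where
  "p_flow net x y i =
     (\<Sum>j=1..nbus net. gY net i j * (x i * x j + y i * y j))
   + (\<Sum>j=1..nbus net. bY net i j * (y i * x j - x i * y j))"

definition q_flow :: "zip_network \<Rightarrow> (nat \<Rightarrow> real) \<Rightarrow> (nat \<Rightarrow> real) \<Rightarrow> nat \<Rightarrow> real" where
  "q_flow net x y i =
   - (\<Sum>j=1..nbus net. bY net i j * (x i * x j + y i * y j))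
   + (\<Sum>j=1..nbus net. gY net i j * (y i * x j - x i * y j))"

definition p_ZIP :: "zip_network \<Rightarrow> (nat \<Rightarrow> real) \<Rightarrow> (nat \<Rightarrow> real) \<Rightarrow> nat \<Rightarrow> real" where
  "p_ZIP net x y i =
     alphaZ net i * (Re (z_sp net i) / (cmod (z_sp net i))\<^sup>2) * ((x i)\<^sup>2 + (y i)\<^sup>2)
   + alphaI net i * (x i * Re (i_sp net i) + y i * Im (i_sp net i))
   + alphaP net i * p_sp net i"

definition q_ZIP :: "zip_network \<Rightarrow> (nat \<Rightarrow> real) \<Rightarrow> (nat \<Rightarrow> real) \<Rightarrow> nat \<Rightarrow> real" where
  "q_ZIP net x y i =
     betaZ net i * (Im (z_sp net i) / (cmod (z_sp net i))\<^sup>2) * ((x i)\<^sup>2 + (y i)\<^sup>2)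
   + betaI net i * (y i * Re (i_sp net i) - x i * Im (i_sp net i))
   + betaP net i * q_sp net i"

context
  fixes net :: zip_network
    and e f :: "nat \<Rightarrow> real \<Rightarrow> real"
    and l :: "real \<Rightarrow> real"
begin

definition PV_p_eq :: "nat \<Rightarrow> equation" where
  "PV_p_eq i = ((\<lambda>t. p_sp net i),
     (\<lambda>t. - l t * dp net i + p_flow net (\<lambda>j. e j t) (\<lambda>j. f j t) i))"

definition PQ_p_eq :: "nat \<Rightarrow> equation" where
  "PQ_p_eq i = ((\<lambda>t. p_ZIP net (\<lambda>j. e j t) (\<lambda>j. f j t) i),
     (\<lambda>t. - l t * dp net i + p_flow net (\<lambda>j. e j t) (\<lambda>j. f j t) i))"

definition PQ_q_eq :: "nat \<Rightarrow> equation" where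
  "PQ_q_eq i = ((\<lambda>t. q_ZIP net (\<lambda>j. e j t) (\<lambda>j. f j t) i),
     (\<lambda>t. - l t * dq net i + q_flow net (\<lambda>j. e j t) (\<lambda>j. f j t) i))"

definition PV_v_eq :: "nat \<Rightarrow> equation" where
  "PV_v_eq i = ((\<lambda>t. (v_sp net i)\<^sup>2), (\<lambda>t. (e i t)\<^sup>2 + (f i t)\<^sup>2))"

definition REF_e_eq :: "nat \<Rightarrow> equation" where
  "REF_e_eq i = ((\<lambda>t. e_sp net i), (\<lambda>t. e i t))"

definition REF_f_eq :: "nat \<Rightarrow> equation" where
  "REF_f_eq i = ((\<lambda>t. f_sp net i), (\<lambda>t. f i t))"

definition power_flow_eqs :: "equation list" where
  "power_flow_eqs =
     interleave (PQ_buses net) PQ_p_eq PQ_q_eq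
   @ interleave (PV_buses net) PV_p_eq PV_v_eq
   @ [REF_e_eq (nbus net), REF_f_eq (nbus net)]"

text \<open>The order-\<open>k\<close> transform of the vector function \<open>g(y(t), \<lambda>(t))\<close>.\<close>

definition DT_g :: "nat \<Rightarrow> real vec" where
  "DT_g k = vec_of_list (map (\<lambda>q. DT (residual q) k) power_flow_eqs)"

end

section \<open>The linear equation of order \<open>k\<close>\<close>

definition Y_vec :: "zip_network \<Rightarrow> (nat \<Rightarrow> nat \<Rightarrow> real) \<Rightarrow> (nat \<Rightarrow> nat \<Rightarrow> real) \<Rightarrow> nat \<Rightarrow> real vec" where
  "Y_vec net E F k = vec_of_list (interleave (all_buses net) (\<lambda>i. E i k) (\<lambda>i. F i k))"

text \<open>Below, \<open>E i m\<close> and \<open>F i m\<close> are the order-\<open>m\<close> coefficients of bus \<open>i\<close>. The coefficients of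
  the loading parameter occur in none of the matrices, so they are not parameters.\<close>

context
  fixes net :: zip_network
    and E F :: "nat \<Rightarrow> nat \<Rightarrow> real"
begin

definition row_of :: "(nat \<Rightarrow> real) \<Rightarrow> (nat \<Rightarrow> real) \<Rightarrow> real vec" where
  "row_of a b = vec_of_list (interleave (all_buses net) a b)"

definition unit_row :: "nat \<Rightarrow> real \<Rightarrow> real \<Rightarrow> real vec" where
  "unit_row i a b = row_of (\<lambda>j. if j = i then a else 0) (\<lambda>j. if j = i then b else 0)"

definition alpha_P :: "nat \<Rightarrow> nat \<Rightarrow> real" where
  "alpha_P i j =
    (if j = i
     then (\<Sum>h=1..nbus net. gY net i h * E h 0 - bY net i h * F h 0)
          + gY net i i * E i 0 + bY net i i * F i 0
     else gY net i j * E i 0 + bY net i j * F i 0)"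

definition beta_P :: "nat \<Rightarrow> nat \<Rightarrow> real" where
  "beta_P i j =
    (if j = i
     then (\<Sum>h=1..nbus net. bY net i h * E h 0 + gY net i h * F h 0)
          - bY net i i * E i 0 + gY net i i * F i 0
     else gY net i j * F i 0 - bY net i j * E i 0)"

definition phi_Q :: "nat \<Rightarrow> nat \<Rightarrow> real" where
  "phi_Q i j =
    (if j = i
     then - (\<Sum>h=1..nbus net. bY net i h * E h 0 + gY net i h * F h 0)
          - bY net i i * E i 0 + gY net i i * F i 0
     else - bY net i j * E i 0 + gY net i j * F i 0)"

definition psi_Q :: "nat \<Rightarrow> nat \<Rightarrow> real" where
  "psi_Q i j =
    (if j = i
     then (\<Sum>h=1..nbus net. gY net i h * E h 0 - bY net i h * F h 0)
          - gY net i i * E i 0 - bY net i i * F i 0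
     else - bY net i j * F i 0 - gY net i j * E i 0)"

definition a_P :: "nat \<Rightarrow> real vec" where
  "a_P i = row_of (alpha_P i) (beta_P i)"

definition a_Q :: "nat \<Rightarrow> real vec" where
  "a_Q i = row_of (phi_Q i) (psi_Q i)"

definition a_V :: "nat \<Rightarrow> real vec" where
  "a_V i = unit_row i (2 * E i 0) (2 * F i 0)"

definition a_E :: "nat \<Rightarrow> real vec" where
  "a_E i = unit_row i 1 0"

definition a_F :: "nat \<Rightarrow> real vec" where
  "a_F i = unit_row i 0 1"

definition tau1 :: "nat \<Rightarrow> real" where
  "tau1 i = alphaZ net i * (2 * E i 0 * Re (z_sp net i) / (cmod (z_sp net i))\<^sup>2)
          + alphaI net i * Re (i_sp net i)"

definition tau2 :: "nat \<Rightarrow> real" where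
  "tau2 i = alphaZ net i * (2 * F i 0 * Re (z_sp net i) / (cmod (z_sp net i))\<^sup>2)
          + alphaI net i * Im (i_sp net i)"

definition tau3 :: "nat \<Rightarrow> real" where
  "tau3 i = betaZ net i * (2 * E i 0 * Im (z_sp net i) / (cmod (z_sp net i))\<^sup>2)
          - betaI net i * Im (i_sp net i)"

definition tau4 :: "nat \<Rightarrow> real" where
  "tau4 i = betaZ net i * (2 * F i 0 * Im (z_sp net i) / (cmod (z_sp net i))\<^sup>2)
          + betaI net i * Re (i_sp net i)"

definition a_ZIP :: "nat \<Rightarrow> real vec" where
  "a_ZIP i = unit_row i (tau1 i) (tau2 i)"

definition c_ZIP :: "nat \<Rightarrow> real vec" where
  "c_ZIP i = unit_row i (tau3 i) (tau4 i)"

definition a_P_bar :: "nat \<Rightarrow> real vec" where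
  "a_P_bar i = a_P i - a_ZIP i"

definition a_Q_bar :: "nat \<Rightarrow> real vec" where
  "a_Q_bar i = a_Q i - c_ZIP i"

definition c_conv :: "nat \<Rightarrow> nat \<Rightarrow> nat \<Rightarrow> real" where
  "c_conv k i j = (\<Sum>m\<in>{1..<k}. E i m * E j (k - m)) + (\<Sum>m\<in>{1..<k}. F i m * F j (k - m))"

definition d_conv :: "nat \<Rightarrow> nat \<Rightarrow> nat \<Rightarrow> real" where
  "d_conv k i j = (\<Sum>m\<in>{1..<k}. F i m * E j (k - m)) - (\<Sum>m\<in>{1..<k}. E i m * F j (k - m))"

definition eps :: "nat \<Rightarrow> nat \<Rightarrow> real" where
  "eps k i = (\<Sum>j=1..nbus net. gY net i j * c_conv k i j)
           + (\<Sum>j=1..nbus net. bY net i j * d_conv k i j) - p_sp net i * rho k"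

definition mu :: "nat \<Rightarrow> nat \<Rightarrow> real" where
  "mu k i = - (\<Sum>j=1..nbus net. bY net i j * c_conv k i j)
          + (\<Sum>j=1..nbus net. gY net i j * d_conv k i j) - q_sp net i * rho k"

definition sigma_V :: "nat \<Rightarrow> nat \<Rightarrow> real" where
  "sigma_V k i = c_conv k i i - (v_sp net i)\<^sup>2 * rho k"

definition b_ZIP :: "nat \<Rightarrow> nat \<Rightarrow> real" where
  "b_ZIP k i = alphaZ net i * (Re (z_sp net i) / (cmod (z_sp net i))\<^sup>2) * c_conv k i i
             + alphaP net i * p_sp net i * rho k"

definition d_ZIP :: "nat \<Rightarrow> nat \<Rightarrow> real" where
  "d_ZIP k i = betaZ net i * (Im (z_sp net i) / (cmod (z_sp net i))\<^sup>2) * c_conv k i i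
             + betaP net i * q_sp net i * rho k"

definition eps_bar :: "nat \<Rightarrow> nat \<Rightarrow> real" where
  "eps_bar k i = eps k i + p_sp net i * rho k - b_ZIP k i"

definition mu_bar :: "nat \<Rightarrow> nat \<Rightarrow> real" where
  "mu_bar k i = mu k i + q_sp net i * rho k - d_ZIP k i"

definition A_y_PQ :: "real mat" where
  "A_y_PQ = mat_of_rows (2 * nbus net) (interleave (PQ_buses net) a_P_bar a_Q_bar)"

definition A_y_PV :: "real mat" where
  "A_y_PV = mat_of_rows (2 * nbus net) (interleave (PV_buses net) a_P a_V)"

definition A_y_REF :: "real mat" where
  "A_y_REF = mat_of_rows (2 * nbus net) [a_E (nbus net), a_F (nbus net)]"

definition A_gy :: "real mat" where
  "A_gy = A_y_PQ @\<^sub>r A_y_PV @\<^sub>r A_y_REF"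

definition B_PQ :: "nat \<Rightarrow> real vec" where
  "B_PQ k = vec_of_list (interleave (PQ_buses net) (eps_bar k) (mu_bar k))"

definition B_PV :: "nat \<Rightarrow> real vec" where
  "B_PV k = vec_of_list (interleave (PV_buses net) (eps k) (sigma_V k))"

definition B_REF :: "nat \<Rightarrow> real vec" where
  "B_REF k = vec_of_list [- e_sp net (nbus net) * rho k, - f_sp net (nbus net) * rho k]"

definition B_g :: "nat \<Rightarrow> real vec" where
  "B_g k = B_PQ k @\<^sub>v B_PV k @\<^sub>v B_REF k"

end

text \<open>The factor of the scalar \<open>\<Lambda>(k)\<close> has a single column and is rendered as a vector.\<close>

definition A_l_PQ :: "zip_network \<Rightarrow> real vec" where
  "A_l_PQ net = - vec_of_list (interleave (PQ_buses net) (dp net) (dq net))"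

definition A_l_PV :: "zip_network \<Rightarrow> real vec" where
  "A_l_PV net = - vec_of_list (interleave (PV_buses net) (dp net) (\<lambda>i. 0))"

definition A_l_REF :: "real vec" where
  "A_l_REF = vec_of_list [0, 0]"

definition A_gl :: "zip_network \<Rightarrow> real vec" where
  "A_gl net = A_l_PQ net @\<^sub>v A_l_PV net @\<^sub>v A_l_REF"

end

theory Submission
  imports Defs "HOL-Computational_Algebra.Formal_Power_Series"
begin

no_notation inner (infix \<open>\<bullet>\<close> 70) and vec_nth (infixl \<open>$\<close> 90)

text \<open>Taylor expansion at \<open>0\<close> is a ring homomorphism from germs of smooth functions to formal power
  series. Every equation is quadratic, and for \<open>k \<ge> 1\<close> the only terms of the \<open>k\<close>-th coefficient of
  a product \<open>X Y\<close> that contain unknowns of order \<open>k\<close> are \<open>X(0) Y(k)\<close> and \<open>X(k) Y(0)\<close>; collecting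
  them gives the rows of the matrix, and the other terms go into the constant vector.\<close>

section \<open>Taylor expansions and the differential transformation\<close>

text \<open>\<open>T t\<close> is the Taylor series of \<open>x\<close> at \<open>t\<close>. Smoothness is the statement that differentiating the
  coefficients of \<open>T t\<close> in \<open>t\<close> is the same as differentiating the series. Closure under products is
  then the product rule for formal power series.\<close>

definition taylor_on :: "real set \<Rightarrow> (real \<Rightarrow> real) \<Rightarrow> (real \<Rightarrow> real fps) \<Rightarrow> bool" where
  "taylor_on S x T \<longleftrightarrow> open S \<and> 0 \<in> S \<and> (\<forall>t\<in>S. fps_nth (T t) 0 = x t \<and>
     (\<forall>n. ((\<lambda>s. fps_nth (T s) n) has_field_derivative fps_nth (fps_deriv (T t)) n) (at t)))"

definition has_taylor :: "(real \<Rightarrow> real) \<Rightarrow> real fps \<Rightarrow> bool" where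
  "has_taylor x X \<longleftrightarrow> (\<exists>S T. taylor_on S x T \<and> T 0 = X)"

lemma has_taylorI: "taylor_on S x T \<Longrightarrow> T 0 = X \<Longrightarrow> has_taylor x X"
  unfolding has_taylor_def by blast

lemma has_taylorE:
  assumes "has_taylor x X"
  obtains S T where "taylor_on S x T" "T 0 = X"
  using assms unfolding has_taylor_def by blast

lemma taylor_onI:
  assumes "open S" "0 \<in> S" "\<And>t. t \<in> S \<Longrightarrow> fps_nth (T t) 0 = x t"
    and "\<And>t n. t \<in> S \<Longrightarrow>
      ((\<lambda>s. fps_nth (T s) n) has_field_derivative fps_nth (fps_deriv (T t)) n) (at t)"
  shows "taylor_on S x T"
  using assms unfolding taylor_on_def by blast

lemma taylor_onD:
  assumes "taylor_on S x T"
  shows "open S" "0 \<in> S" "t \<in> S \<Longrightarrow> fps_nth (T t) 0 = x t"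
    and "t \<in> S \<Longrightarrow>
      ((\<lambda>s. fps_nth (T s) n) has_field_derivative fps_nth (fps_deriv (T t)) n) (at t)"
  using assms unfolding taylor_on_def by blast+

text \<open>The point \<open>t\<close> stays arbitrary in the induction: differentiating once more
  needs the formula on a whole neighbourhood of \<open>t\<close>, here \<open>S\<close>. The factor
  \<open>n + 1\<close> in the \<open>n\<close>-th coefficient of \<open>fps_deriv\<close> turns
  \<open>fact n\<close> into \<open>fact (Suc n)\<close>.\<close>

lemma taylor_on_higher_deriv:
  assumes "taylor_on S x T" "t \<in> S"
  shows "(deriv ^^ n) x t = fact n * fps_nth (T t) n"
  using assms(2)
proof (induction n arbitrary: t)
  case 0
  then show ?case by (simp add: taylor_onD(3)[OF assms(1)])
next
  case (Suc n)
  have "((\<lambda>s. fact n * fps_nth (T s) n) has_field_derivative fact n * fps_nth (fps_deriv (T t)) n) (at t)"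
    by (rule DERIV_cmult[OF taylor_onD(4)[OF assms(1) Suc.prems]])
  then have "((deriv ^^ n) x has_field_derivative fact n * fps_nth (fps_deriv (T t)) n) (at t)"
    by (rule has_field_derivative_transform_within_open[OF _ taylor_onD(1)[OF assms(1)] Suc.prems])
       (simp add: Suc.IH)
  then show ?case
    by (simp add: DERIV_imp_deriv algebra_simps)
qed

text \<open>This makes the series in \<open>has_taylor\<close> unique and reduces every computation
  of a \<open>DT\<close> to reading off a coefficient.\<close>

lemma has_taylor_DT:
  assumes "has_taylor x X"
  shows "DT x k = fps_nth X k"
proof -
  from assms obtain S T where T: "taylor_on S x T" "T 0 = X" by (rule has_taylorE)
  from taylor_on_higher_deriv[OF T(1) taylor_onD(2)[OF T(1)]] T(2) show ?thesis
    by (simp add: DT_def)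
qed

text \<open>The radius in \<open>smooth_near_0\<close> is the same for all orders, so one interval
  serves all coefficients of the series at once.\<close>

lemma smooth_near_0_imp_has_taylor:
  assumes "smooth_near_0 x"
  shows "has_taylor x (Abs_fps (DT x))"
proof -
  from assms obtain r where r: "r > 0"
    and d: "\<And>n t. \<bar>t\<bar> < r \<Longrightarrow> (deriv ^^ n) x differentiable (at t)"
    unfolding smooth_near_0_def by blast
  define T where "T t = Abs_fps (\<lambda>n. (deriv ^^ n) x t / fact n)" for t
  have "taylor_on {-r<..<r} x T"
  proof (rule taylor_onI)
    fix t n assume "t \<in> {-r<..<r}"
    then have "(deriv ^^ n) x differentiable (at t)" using d by auto
    then have "((deriv ^^ n) x has_field_derivative deriv ((deriv ^^ n) x) t) (at t)"
      by (simp add: DERIV_deriv_iff_real_differentiable)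
    \<comment> \<open>The factor \<open>n + 1\<close> from \<open>fps_deriv\<close> cancels against
      \<open>fact (Suc n)\<close> and leaves \<open>fact n\<close> in the denominator.\<close>
    from DERIV_cdivide[OF this, of "fact n"]
    show "((\<lambda>s. fps_nth (T s) n) has_field_derivative fps_nth (fps_deriv (T t)) n) (at t)"
      by (simp add: T_def)
  qed (use r in \<open>auto simp: T_def\<close>)
  moreover have "T 0 = Abs_fps (DT x)" by (simp add: T_def DT_def fps_eq_iff)
  ultimately show ?thesis by (rule has_taylorI)
qed

text \<open>In \<open>taylor_on\<close> the function \<open>x\<close> occurs only in the condition
  on the coefficient of order 0, so the same \<open>T\<close> works after shrinking
  \<open>S\<close>. This carries equations that hold near 0 over to their transforms.\<close>

lemma has_taylor_cong:
  assumes "has_taylor x X" "\<forall>\<^sub>F t in nhds 0. x t = y t"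
  shows "has_taylor y X"
proof -
  from assms(2) obtain U where U: "open U" "0 \<in> U" "\<And>t. t \<in> U \<Longrightarrow> x t = y t"
    by (auto simp: eventually_nhds)
  from assms(1) obtain S T where T: "taylor_on S x T" "T 0 = X" by (rule has_taylorE)
  have "taylor_on (S \<inter> U) y T"
    using U taylor_onD[OF T(1)] by (intro taylor_onI) auto
  then show ?thesis using T(2) by (rule has_taylorI)
qed

lemma has_taylor_const: "has_taylor (\<lambda>t. c) (fps_const c)"
  by (rule has_taylorI[of UNIV _ "\<lambda>t. fps_const c"]) (auto intro: taylor_onI)

lemma has_taylor_add:
  assumes "has_taylor x X" "has_taylor y Y"
  shows "has_taylor (\<lambda>t. x t + y t) (X + Y)"
proof -
  from assms(1) obtain S T where T: "taylor_on S x T" "T 0 = X" by (rule has_taylorE)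
  from assms(2) obtain S' T' where T': "taylor_on S' y T'" "T' 0 = Y" by (rule has_taylorE)
  have "taylor_on (S \<inter> S') (\<lambda>t. x t + y t) (\<lambda>t. T t + T' t)"
  proof (rule taylor_onI)
    fix t n assume "t \<in> S \<inter> S'"
    then show "((\<lambda>s. fps_nth (T s + T' s) n) has_field_derivative
        fps_nth (fps_deriv (T t + T' t)) n) (at t)"
      unfolding fps_deriv_add fps_add_nth
      by (intro DERIV_add taylor_onD(4)[OF T(1)] taylor_onD(4)[OF T'(1)]) auto
  qed (use taylor_onD[OF T(1)] taylor_onD[OF T'(1)] in auto)
  then show ?thesis by (rule has_taylorI) (simp add: T T')
qed

text \<open>Each coefficient of the product is a finite Cauchy sum and can be differentiated term by
  term; the result is the Leibniz rule for \<open>fps_deriv\<close>.\<close>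

lemma has_taylor_mult:
  assumes "has_taylor x X" "has_taylor y Y"
  shows "has_taylor (\<lambda>t. x t * y t) (X * Y)"
proof -
  from assms(1) obtain S T where T: "taylor_on S x T" "T 0 = X" by (rule has_taylorE)
  from assms(2) obtain S' T' where T': "taylor_on S' y T'" "T' 0 = Y" by (rule has_taylorE)
  have "taylor_on (S \<inter> S') (\<lambda>t. x t * y t) (\<lambda>t. T t * T' t)"
  proof (rule taylor_onI)
    fix t n assume t: "t \<in> S \<inter> S'"
    have "((\<lambda>s. \<Sum>i=0..n. fps_nth (T s) i * fps_nth (T' s) (n - i)) has_field_derivative
       (\<Sum>i=0..n. fps_nth (fps_deriv (T t)) i * fps_nth (T' t) (n - i) +
          fps_nth (fps_deriv (T' t)) (n - i) * fps_nth (T t) i)) (at t)"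
      using t by (intro DERIV_sum DERIV_mult taylor_onD(4)[OF T(1)] taylor_onD(4)[OF T'(1)]) auto
    also have "(\<lambda>s. \<Sum>i=0..n. fps_nth (T s) i * fps_nth (T' s) (n - i)) = (\<lambda>s. fps_nth (T s * T' s) n)"
      by (simp add: fps_mult_nth)
    \<comment> \<open>Splitting the sum gives the two Cauchy products of the Leibniz rule;
      commutativity undoes the order of factors that \<open>DERIV_mult\<close> produces.\<close>
    also have "(\<Sum>i=0..n. fps_nth (fps_deriv (T t)) i * fps_nth (T' t) (n - i) +
          fps_nth (fps_deriv (T' t)) (n - i) * fps_nth (T t) i) =
        fps_nth (T t * fps_deriv (T' t) + fps_deriv (T t) * T' t) n"
      by (simp only: fps_mult_nth fps_add_nth sum.distrib add.commute mult.commute[of "fps_nth (T t) _"])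
    also have "T t * fps_deriv (T' t) + fps_deriv (T t) * T' t = fps_deriv (T t * T' t)"
      by simp
    finally show "((\<lambda>s. fps_nth (T s * T' s) n) has_field_derivative
        fps_nth (fps_deriv (T t * T' t)) n) (at t)" .
  qed (use taylor_onD[OF T(1)] taylor_onD[OF T'(1)] in auto)
  then show ?thesis by (rule has_taylorI) (simp add: T T')
qed

lemma has_taylor_uminus:
  assumes "has_taylor x X"
  shows "has_taylor (\<lambda>t. - x t) (- X)"
  using has_taylor_mult[OF has_taylor_const[of "-1"] assms]
  by (simp flip: fps_const_neg)

lemma has_taylor_diff:
  assumes "has_taylor x X" "has_taylor y Y"
  shows "has_taylor (\<lambda>t. x t - y t) (X - Y)"
  using has_taylor_add[OF assms(1) has_taylor_uminus[OF assms(2)]] by simp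

lemma has_taylor_power2:
  assumes "has_taylor x X"
  shows "has_taylor (\<lambda>t. (x t)\<^sup>2) (X * X)"
  using has_taylor_mult[OF assms assms] by (simp add: power2_eq_square)

lemma has_taylor_sum:
  assumes "\<And>i. i \<in> A \<Longrightarrow> has_taylor (x i) (X i)"
  shows "has_taylor (\<lambda>t. \<Sum>i\<in>A. x i t) (\<Sum>i\<in>A. X i)"
  using assms
proof (induction A rule: infinite_finite_induct)
  case (insert a A)
  then show ?case by (simp add: has_taylor_add)
qed (use has_taylor_const[of 0] in simp_all)

lemmas has_taylor_intros =
  has_taylor_const has_taylor_add has_taylor_mult has_taylor_uminus has_taylor_diff
  has_taylor_power2 has_taylor_sum

lemma fps_mult_nth_split:
  fixes X Y :: "'a :: comm_semiring_1 fps"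
  assumes "k \<ge> 1"
  shows "fps_nth (X * Y) k = fps_nth X 0 * fps_nth Y k + fps_nth X k * fps_nth Y 0
    + (\<Sum>m\<in>{1..<k}. fps_nth X m * fps_nth Y (k - m))"
proof -
  \<comment> \<open>Since \<open>k \<ge> 1\<close>, the indices 0 and \<open>k\<close> are distinct
    and give two separate end terms.\<close>
  have "{0..k} = insert 0 (insert k {1..<k})" using assms by auto
  then show ?thesis using assms by (simp add: fps_mult_nth algebra_simps)
qed

section \<open>Interleaved lists\<close>

lemma interleave_Nil [simp]: "interleave [] a b = []"
  by (simp add: interleave_def)

lemma interleave_Cons [simp]: "interleave (i # is) a b = a i # b i # interleave is a b"
  by (simp add: interleave_def)

lemma length_interleave [simp]: "length (interleave is a b) = 2 * length is"
  by (induction "is") auto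

lemma set_interleave: "set (interleave is a b) = a ` set is \<union> b ` set is"
  by (induction "is") auto

lemma map_interleave: "map h (interleave is a b) = interleave is (\<lambda>i. h (a i)) (\<lambda>i. h (b i))"
  by (induction "is") auto

lemma interleave_cong:
  assumes "\<And>i. i \<in> set is \<Longrightarrow> a i = a' i" "\<And>i. i \<in> set is \<Longrightarrow> b i = b' i"
  shows "interleave is a b = interleave is a' b'"
  using assms by (induction "is") auto

text \<open>\<open>vec_of_list\<close> turns a list constructor into \<open>vCons\<close>, so this
  and the next two rules drive the inductions over interleaved lists.\<close>

lemma vCons_add: "vCons a v + vCons b w = vCons (a + b) (v + w)"
  by (rule eq_vecI) (auto simp: vec_index_vCons)

lemma vCons_smult: "c \<cdot>\<^sub>v vCons a v = vCons (c * a) (c \<cdot>\<^sub>v v)"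
  by (rule eq_vecI) (auto simp: vec_index_vCons)

lemma vCons_uminus: "- vCons a v = vCons (- a) (- v)"
  by (rule eq_vecI) (auto simp: vec_index_vCons)

lemma vec_of_list_interleave_add:
  "vec_of_list (interleave is a b) + vec_of_list (interleave is c d) =
   vec_of_list (interleave is (\<lambda>i. a i + c i) (\<lambda>i. b i + d i))"
  by (induction "is") (auto simp: vCons_add)

lemma vec_of_list_interleave_smult:
  "c \<cdot>\<^sub>v vec_of_list (interleave is a b) = vec_of_list (interleave is (\<lambda>i. c * a i) (\<lambda>i. c * b i))"
  by (induction "is") (auto simp: vCons_smult)

lemma vec_of_list_interleave_uminus:
  "- vec_of_list (interleave is a b) = vec_of_list (interleave is (\<lambda>i. - a i) (\<lambda>i. - b i))"
  by (induction "is") (auto simp: vCons_uminus)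

text \<open>Rows and unknowns are interleaved in the same order, so a row times \<open>Y_vec\<close>
  becomes a sum over buses with one \<open>E\<close> term and one \<open>F\<close> term
  each.\<close>

lemma scalar_prod_interleave:
  "vec_of_list (interleave is a b) \<bullet> vec_of_list (interleave is c d) =
   (\<Sum>i\<leftarrow>is. a i * c i + b i * d i)"
  by (induction "is") (auto simp: add.assoc)

lemma vec_of_list_append: "vec_of_list xs @\<^sub>v vec_of_list ys = vec_of_list (xs @ ys)"
  by (induction xs) auto

text \<open>The dimension condition makes \<open>row (mat_of_rows n rs) i\<close> equal to
  \<open>rs ! i\<close>.\<close>

lemma mat_of_rows_mult_vec:
  assumes "set rs \<subseteq> carrier_vec n"
  shows "mat_of_rows n rs *\<^sub>v v = vec_of_list (map (\<lambda>r. r \<bullet> v) rs)"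
proof (rule eq_vecI)
  fix i assume "i < dim_vec (vec_of_list (map (\<lambda>r. r \<bullet> v) rs))"
  then have i: "i < length rs" by simp
  then have "rs ! i \<in> carrier_vec n" using assms by auto
  with i show "(mat_of_rows n rs *\<^sub>v v) $ i = vec_of_list (map (\<lambda>r. r \<bullet> v) rs) $ i"
    by (simp add: index_vec_of_list del: vec_of_list_map)
qed simp

section \<open>The rows of the linear equation\<close>

lemma set_all_buses: "set (all_buses net) = {1..nbus net}"
  by (auto simp: all_buses_def)

lemma row_of_carrier [simp]: "row_of net a b \<in> carrier_vec (2 * nbus net)"
  by (simp add: carrier_dim_vec row_of_def all_buses_def)

lemma row_of_scalar_prod:
  "row_of net a b \<bullet> Y_vec net E F k = (\<Sum>j=1..nbus net. a j * E j k + b j * F j k)"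
proof -
  have "distinct (all_buses net)" by (simp add: all_buses_def)
  then show ?thesis
    by (simp add: row_of_def Y_vec_def scalar_prod_interleave sum_list_distinct_conv_sum_set set_all_buses)
qed

lemma unit_row_scalar_prod:
  assumes "i \<in> {1..nbus net}"
  shows "unit_row net i a b \<bullet> Y_vec net E F k = a * E i k + b * F i k"
proof -
  have "unit_row net i a b \<bullet> Y_vec net E F k =
      (\<Sum>j=1..nbus net. if j = i then a * E i k + b * F i k else 0)"
    unfolding unit_row_def row_of_scalar_prod by (intro sum.cong) simp_all
  also have "\<dots> = a * E i k + b * F i k"
    using assms by (subst sum.delta) simp_all
  finally show ?thesis .
qed

lemma unit_row_carrier [simp]: "unit_row net i a b \<in> carrier_vec (2 * nbus net)"
  by (simp add: unit_row_def)

lemma Y_vec_carrier [simp]: "Y_vec net E F k \<in> carrier_vec (2 * nbus net)"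
  by (simp add: carrier_dim_vec Y_vec_def all_buses_def)

lemma a_P_carrier [simp]: "a_P net E F i \<in> carrier_vec (2 * nbus net)"
  by (simp add: a_P_def)

lemma a_Q_carrier [simp]: "a_Q net E F i \<in> carrier_vec (2 * nbus net)"
  by (simp add: a_Q_def)

lemma a_V_carrier [simp]: "a_V net E F i \<in> carrier_vec (2 * nbus net)"
  by (simp add: a_V_def)

lemma a_P_bar_carrier [simp]: "a_P_bar net E F i \<in> carrier_vec (2 * nbus net)"
  by (simp add: a_P_bar_def a_ZIP_def)

lemma a_Q_bar_carrier [simp]: "a_Q_bar net E F i \<in> carrier_vec (2 * nbus net)"
  by (simp add: a_Q_bar_def c_ZIP_def)

text \<open>The right-hand side is the derivative of \<open>p_flow\<close> at the order-0 values,
  applied to the order-\<open>k\<close> coefficients. Terms with an order-\<open>k\<close> factor of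
  bus \<open>j\<close> give the generic entry of column \<open>j\<close>; terms with the factor
  \<open>E i k\<close> or \<open>F i k\<close> occur for every \<open>j\<close>, and their sum is
  the extra part of the diagonal entries.\<close>

lemma a_P_scalar_prod:
  assumes "i \<in> {1..nbus net}"
  shows "a_P net E F i \<bullet> Y_vec net E F k =
    (\<Sum>j=1..nbus net. gY net i j * (E i 0 * E j k + E i k * E j 0 + (F i 0 * F j k + F i k * F j 0)))
  + (\<Sum>j=1..nbus net. bY net i j * (F i 0 * E j k + F i k * E j 0 - (E i 0 * F j k + E i k * F j 0)))"
proof -
  \<comment> \<open>\<open>S\<close> and \<open>R\<close> are the extra parts of the diagonal
    entries, multiplying \<open>E i k\<close> and \<open>F i k\<close>; \<open>?t j\<close> is the
    generic entry pair, which the diagonal contains as well.\<close>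
  define S where "S = (\<Sum>h=1..nbus net. gY net i h * E h 0 - bY net i h * F h 0)"
  define R where "R = (\<Sum>h=1..nbus net. bY net i h * E h 0 + gY net i h * F h 0)"
  let ?t = "\<lambda>j. (gY net i j * E i 0 + bY net i j * F i 0) * E j k
       + (gY net i j * F i 0 - bY net i j * E i 0) * F j k"
  have "a_P net E F i \<bullet> Y_vec net E F k =
     (\<Sum>j=1..nbus net. ?t j + (if j = i then S * E i k + R * F i k else 0))"
    unfolding a_P_def row_of_scalar_prod
    by (intro sum.cong) (simp_all add: alpha_P_def beta_P_def S_def R_def algebra_simps)
  also have "\<dots> = (\<Sum>j=1..nbus net. ?t j) + (S * E i k + R * F i k)"
    using assms by (simp only: sum.distrib sum.delta) simp
  \<comment> \<open>The diagonal extra is spread back over all \<open>j\<close>, so that the final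
    comparison can be made summand by summand.\<close>
  also have "\<dots> = (\<Sum>j=1..nbus net. ?t j
       + ((gY net i j * E j 0 - bY net i j * F j 0) * E i k
       + (bY net i j * E j 0 + gY net i j * F j 0) * F i k))"
    by (simp only: S_def R_def sum_distrib_right) (simp only: sum.distrib)
  also have "\<dots> = (\<Sum>j=1..nbus net.
      gY net i j * (E i 0 * E j k + E i k * E j 0 + (F i 0 * F j k + F i k * F j 0))
    + bY net i j * (F i 0 * E j k + F i k * E j 0 - (E i 0 * F j k + E i k * F j 0)))"
    by (intro sum.cong) (simp_all add: algebra_simps)
  finally show ?thesis
    by (simp only: sum.distrib)
qed

text \<open>\<open>q_flow\<close> arises from \<open>p_flow\<close> by putting \<open>- bY\<close>
  for \<open>gY\<close> and \<open>gY\<close> for \<open>bY\<close>. This substitution sends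
  \<open>S\<close> to \<open>- R\<close> and \<open>R\<close> to \<open>S\<close>, which explains
  the diagonal extra below.\<close>

lemma a_Q_scalar_prod:
  assumes "i \<in> {1..nbus net}"
  shows "a_Q net E F i \<bullet> Y_vec net E F k =
  - (\<Sum>j=1..nbus net. bY net i j * (E i 0 * E j k + E i k * E j 0 + (F i 0 * F j k + F i k * F j 0)))
  + (\<Sum>j=1..nbus net. gY net i j * (F i 0 * E j k + F i k * E j 0 - (E i 0 * F j k + E i k * F j 0)))"
proof -
  define S where "S = (\<Sum>h=1..nbus net. gY net i h * E h 0 - bY net i h * F h 0)"
  define R where "R = (\<Sum>h=1..nbus net. bY net i h * E h 0 + gY net i h * F h 0)"
  let ?t = "\<lambda>j. (- bY net i j * E i 0 + gY net i j * F i 0) * E j k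
       + (- bY net i j * F i 0 - gY net i j * E i 0) * F j k"
  have "a_Q net E F i \<bullet> Y_vec net E F k =
     (\<Sum>j=1..nbus net. ?t j + (if j = i then S * F i k - R * E i k else 0))"
    unfolding a_Q_def row_of_scalar_prod
    by (intro sum.cong) (simp_all add: phi_Q_def psi_Q_def S_def R_def algebra_simps)
  also have "\<dots> = (\<Sum>j=1..nbus net. ?t j) + (S * F i k - R * E i k)"
    using assms by (simp only: sum.distrib sum.delta) simp
  also have "\<dots> = (\<Sum>j=1..nbus net. ?t j
       + ((gY net i j * E j 0 - bY net i j * F j 0) * F i k
       - (bY net i j * E j 0 + gY net i j * F j 0) * E i k))"
    by (simp only: S_def R_def sum_distrib_right) (simp only: sum.distrib sum_subtractf)
  also have "\<dots> = (\<Sum>j=1..nbus net.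
      - (bY net i j * (E i 0 * E j k + E i k * E j 0 + (F i 0 * F j k + F i k * F j 0)))
      + gY net i j * (F i 0 * E j k + F i k * E j 0 - (E i 0 * F j k + E i k * F j 0)))"
    by (intro sum.cong) (simp_all add: algebra_simps)
  finally show ?thesis
    by (simp only: sum.distrib sum_negf)
qed

section \<open>Order-\<open>k\<close> transforms of the individual power flow equations\<close>

context
  fixes net :: zip_network
    and e f :: "nat \<Rightarrow> real \<Rightarrow> real"
    and l :: "real \<Rightarrow> real"
    and E F :: "nat \<Rightarrow> nat \<Rightarrow> real"
    and L :: "nat \<Rightarrow> real"
    and k :: nat
  assumes e: "\<And>i. i \<in> {1..nbus net} \<Longrightarrow> has_taylor (e i) (Abs_fps (E i))"
    and f: "\<And>i. i \<in> {1..nbus net} \<Longrightarrow> has_taylor (f i) (Abs_fps (F i))"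
    and l: "has_taylor l (Abs_fps L)"
    and k: "k \<ge> 1"
begin

private abbreviation (input) "X i \<equiv> Abs_fps (E i)"
private abbreviation (input) "Z i \<equiv> Abs_fps (F i)"

text \<open>\<open>taylor_c i j\<close> and \<open>taylor_d i j\<close> are the series of the real
  and imaginary parts of the voltage of bus \<open>i\<close> times the conjugate voltage of bus
  \<open>j\<close>. All quadratic terms of the system are built from them.\<close>

private definition taylor_c where "taylor_c i j = X i * X j + Z i * Z j"
private definition taylor_d where "taylor_d i j = Z i * X j - X i * Z j"

private lemma taylor_c_nth:
  "fps_nth (taylor_c i j) k =
     E i 0 * E j k + E i k * E j 0 + (F i 0 * F j k + F i k * F j 0) + c_conv E F k i j"
  using k by (simp add: taylor_c_def fps_mult_nth_split c_conv_def)

private lemma taylor_d_nth: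
  "fps_nth (taylor_d i j) k =
     F i 0 * E j k + F i k * E j 0 - (E i 0 * F j k + E i k * F j 0) + d_conv E F k i j"
  using k by (simp add: taylor_d_def fps_mult_nth_split d_conv_def)

text \<open>A constant contributes only at order 0, so all \<open>rho\<close> terms vanish at the
  orders considered here.\<close>

private lemma rho_k: "rho k = 0"
  using k by (simp add: rho_def)

text \<open>These four series copy the syntax of \<open>p_flow\<close>, \<open>q_flow\<close>,
  \<open>p_ZIP\<close> and \<open>q_ZIP\<close>, so that \<open>has_taylor_intros\<close> can be
  applied term by term.\<close>

private definition p_flow_fps where
  "p_flow_fps i = (\<Sum>j=1..nbus net. fps_const (gY net i j) * taylor_c i j)
                + (\<Sum>j=1..nbus net. fps_const (bY net i j) * taylor_d i j)"

private definition q_flow_fps where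
  "q_flow_fps i = - (\<Sum>j=1..nbus net. fps_const (bY net i j) * taylor_c i j)
                + (\<Sum>j=1..nbus net. fps_const (gY net i j) * taylor_d i j)"

private definition p_ZIP_fps where
  "p_ZIP_fps i =
     fps_const (alphaZ net i * (Re (z_sp net i) / (cmod (z_sp net i))\<^sup>2)) * taylor_c i i
   + fps_const (alphaI net i) * (X i * fps_const (Re (i_sp net i)) + Z i * fps_const (Im (i_sp net i)))
   + fps_const (alphaP net i * p_sp net i)"

private definition q_ZIP_fps where
  "q_ZIP_fps i =
     fps_const (betaZ net i * (Im (z_sp net i) / (cmod (z_sp net i))\<^sup>2)) * taylor_c i i
   + fps_const (betaI net i) * (Z i * fps_const (Re (i_sp net i)) - X i * fps_const (Im (i_sp net i)))
   + fps_const (betaP net i * q_sp net i)"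

private lemma has_taylor_p_flow:
  "i \<in> {1..nbus net} \<Longrightarrow> has_taylor (\<lambda>t. p_flow net (\<lambda>j. e j t) (\<lambda>j. f j t) i) (p_flow_fps i)"
  unfolding p_flow_def p_flow_fps_def taylor_c_def taylor_d_def
  by (intro has_taylor_intros e f)

private lemma has_taylor_q_flow:
  "i \<in> {1..nbus net} \<Longrightarrow> has_taylor (\<lambda>t. q_flow net (\<lambda>j. e j t) (\<lambda>j. f j t) i) (q_flow_fps i)"
  unfolding q_flow_def q_flow_fps_def taylor_c_def taylor_d_def
  by (intro has_taylor_intros e f)

private lemma has_taylor_p_ZIP:
  "i \<in> {1..nbus net} \<Longrightarrow> has_taylor (\<lambda>t. p_ZIP net (\<lambda>j. e j t) (\<lambda>j. f j t) i) (p_ZIP_fps i)"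
  unfolding p_ZIP_def p_ZIP_fps_def taylor_c_def
  by (intro has_taylor_intros e f)

private lemma has_taylor_q_ZIP:
  "i \<in> {1..nbus net} \<Longrightarrow> has_taylor (\<lambda>t. q_ZIP net (\<lambda>j. e j t) (\<lambda>j. f j t) i) (q_ZIP_fps i)"
  unfolding q_ZIP_def q_ZIP_fps_def taylor_c_def
  by (intro has_taylor_intros e f)

text \<open>Distributing \<open>gY\<close> and \<open>bY\<close> separates the terms with an
  order-\<open>k\<close> factor, which are collected by \<open>a_P_scalar_prod\<close>, from the
  convolutions \<open>c_conv\<close> and \<open>d_conv\<close>, which make up
  \<open>eps\<close>.\<close>

private lemma p_flow_fps_nth:
  assumes "i \<in> {1..nbus net}"
  shows "fps_nth (p_flow_fps i) k = a_P net E F i \<bullet> Y_vec net E F k + eps net E F k i"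
  by (simp add: p_flow_fps_def a_P_scalar_prod[OF assms] eps_def fps_sum_nth taylor_c_nth taylor_d_nth
      rho_k distrib_left[of "gY net i _"] distrib_left[of "bY net i _" "_ - _"] sum.distrib)

private lemma q_flow_fps_nth:
  assumes "i \<in> {1..nbus net}"
  shows "fps_nth (q_flow_fps i) k = a_Q net E F i \<bullet> Y_vec net E F k + mu net E F k i"
  by (simp add: q_flow_fps_def a_Q_scalar_prod[OF assms] mu_def fps_sum_nth taylor_c_nth taylor_d_nth
      rho_k distrib_left[of "gY net i _"] distrib_left[of "bY net i _" "_ + _"] sum.distrib)

text \<open>In a square the two end terms coincide, whence the factor 2 in \<open>tau1\<close> and
  \<open>tau2\<close>. The constant-current part is linear and goes into them entirely; the
  constant-power part vanishes at order \<open>k\<close>.\<close>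

private lemma p_ZIP_fps_nth:
  assumes "i \<in> {1..nbus net}"
  shows "fps_nth (p_ZIP_fps i) k = a_ZIP net E F i \<bullet> Y_vec net E F k + b_ZIP net E F k i"
  unfolding p_ZIP_fps_def a_ZIP_def unit_row_scalar_prod[OF assms]
  using k by (simp add: b_ZIP_def rho_k taylor_c_nth tau1_def tau2_def) (simp add: algebra_simps add_divide_distrib)

private lemma q_ZIP_fps_nth:
  assumes "i \<in> {1..nbus net}"
  shows "fps_nth (q_ZIP_fps i) k = c_ZIP net E F i \<bullet> Y_vec net E F k + d_ZIP net E F k i"
  unfolding q_ZIP_fps_def c_ZIP_def unit_row_scalar_prod[OF assms]
  using k by (simp add: d_ZIP_def rho_k taylor_c_nth tau3_def tau4_def) (simp add: algebra_simps add_divide_distrib)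

text \<open>Each side has its own series; this is what permits splitting the \<open>DT\<close> of a
  residual into the difference of the transforms of the two sides.\<close>

lemma has_taylor_power_flow_eqs:
  assumes "npq net < nbus net" "q \<in> set (power_flow_eqs net e f l)"
  shows "\<exists>P Q. has_taylor (fst q) P \<and> has_taylor (snd q) Q"
proof -
  have buses: "set (PQ_buses net) \<subseteq> {1..nbus net}" "set (PV_buses net) \<subseteq> {1..nbus net}"
    "nbus net \<in> {1..nbus net}"
    using assms(1) by (auto simp: PQ_buses_def PV_buses_def)
  have "\<exists>i\<in>{1..nbus net}. q \<in> {PQ_p_eq net e f l i, PQ_q_eq net e f l i, PV_p_eq net e f l i,
      PV_v_eq net e f i, REF_e_eq net e i, REF_f_eq net f i}"
    using assms(2) buses unfolding power_flow_eqs_def set_append set_interleave by auto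
  moreover have "\<forall>q\<in>{PQ_p_eq net e f l i, PQ_q_eq net e f l i, PV_p_eq net e f l i,
      PV_v_eq net e f i, REF_e_eq net e i, REF_f_eq net f i}. \<exists>P Q. has_taylor (fst q) P \<and> has_taylor (snd q) Q"
    if i: "i \<in> {1..nbus net}" for i
    unfolding ball_simps PQ_p_eq_def PQ_q_eq_def PV_p_eq_def PV_v_eq_def REF_e_eq_def
      REF_f_eq_def fst_conv snd_conv
    \<comment> \<open>The witnesses remain schematic until the rules for the two sides instantiate
      them; \<open>TrueI\<close> closes what the empty tail of the set leaves.\<close>
    by (rule conjI exI TrueI has_taylor_intros l has_taylor_p_flow has_taylor_q_flow
          has_taylor_p_ZIP has_taylor_q_ZIP e f i)+
  ultimately show ?thesis by blast
qed

text \<open>The right-hand sides of this and the following five lemmas agree literally with the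
  entries in \<open>linear_form_eq_vec_of_list\<close>, so that whole blocks can be
  rewritten.\<close>

lemma DT_residual_PQ_p:
  assumes i: "i \<in> {1..nbus net}"
  shows "DT (residual (PQ_p_eq net e f l i)) k =
    a_P_bar net E F i \<bullet> Y_vec net E F k + L k * - dp net i + eps_bar net E F k i"
proof -
  have "has_taylor (residual (PQ_p_eq net e f l i))
      (- Abs_fps L * fps_const (dp net i) + p_flow_fps i - p_ZIP_fps i)"
    unfolding residual_def PQ_p_eq_def fst_conv snd_conv
    by (intro has_taylor_intros l has_taylor_p_flow has_taylor_p_ZIP i)
  from has_taylor_DT[OF this] show ?thesis
    by (simp add: p_flow_fps_nth[OF i] p_ZIP_fps_nth[OF i] a_P_bar_def eps_bar_def rho_k a_ZIP_def
        minus_scalar_prod_distrib[of _ "2 * nbus net"])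
qed

lemma DT_residual_PQ_q:
  assumes i: "i \<in> {1..nbus net}"
  shows "DT (residual (PQ_q_eq net e f l i)) k =
    a_Q_bar net E F i \<bullet> Y_vec net E F k + L k * - dq net i + mu_bar net E F k i"
proof -
  have "has_taylor (residual (PQ_q_eq net e f l i))
      (- Abs_fps L * fps_const (dq net i) + q_flow_fps i - q_ZIP_fps i)"
    unfolding residual_def PQ_q_eq_def fst_conv snd_conv
    by (intro has_taylor_intros l has_taylor_q_flow has_taylor_q_ZIP i)
  from has_taylor_DT[OF this] show ?thesis
    by (simp add: q_flow_fps_nth[OF i] q_ZIP_fps_nth[OF i] a_Q_bar_def mu_bar_def rho_k c_ZIP_def
        minus_scalar_prod_distrib[of _ "2 * nbus net"])
qed

lemma DT_residual_PV_p:
  assumes i: "i \<in> {1..nbus net}"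
  shows "DT (residual (PV_p_eq net e f l i)) k =
    a_P net E F i \<bullet> Y_vec net E F k + L k * - dp net i + eps net E F k i"
proof -
  have "has_taylor (residual (PV_p_eq net e f l i))
      (- Abs_fps L * fps_const (dp net i) + p_flow_fps i - fps_const (p_sp net i))"
    unfolding residual_def PV_p_eq_def fst_conv snd_conv
    by (intro has_taylor_intros l has_taylor_p_flow i)
  from has_taylor_DT[OF this] show ?thesis
    using k by (simp add: p_flow_fps_nth[OF i])
qed

text \<open>The term \<open>L k * - 0\<close> reflects that \<open>A_l_PV\<close> is the negative of
  a list with 0 in every second place.\<close>

lemma DT_residual_PV_v:
  assumes i: "i \<in> {1..nbus net}"
  shows "DT (residual (PV_v_eq net e f i)) k =
    a_V net E F i \<bullet> Y_vec net E F k + L k * - 0 + sigma_V net E F k i"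
proof -
  have "has_taylor (residual (PV_v_eq net e f i)) (taylor_c i i - fps_const ((v_sp net i)\<^sup>2))"
    unfolding residual_def PV_v_eq_def fst_conv snd_conv taylor_c_def
    by (intro has_taylor_intros e f i)
  from has_taylor_DT[OF this] show ?thesis
    using k by (simp add: taylor_c_nth a_V_def unit_row_scalar_prod[OF i] sigma_V_def rho_k)
qed

lemma DT_residual_REF_e:
  assumes i: "i \<in> {1..nbus net}"
  shows "DT (residual (REF_e_eq net e i)) k =
    a_E net i \<bullet> Y_vec net E F k + L k * 0 + - e_sp net i * rho k"
proof -
  have "has_taylor (residual (REF_e_eq net e i)) (Abs_fps (E i) - fps_const (e_sp net i))"
    unfolding residual_def REF_e_eq_def fst_conv snd_conv by (intro has_taylor_intros e i)
  from has_taylor_DT[OF this] show ?thesis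
    using k by (simp add: a_E_def unit_row_scalar_prod[OF i] rho_k)
qed

lemma DT_residual_REF_f:
  assumes i: "i \<in> {1..nbus net}"
  shows "DT (residual (REF_f_eq net f i)) k =
    a_F net i \<bullet> Y_vec net E F k + L k * 0 + - f_sp net i * rho k"
proof -
  have "has_taylor (residual (REF_f_eq net f i)) (Abs_fps (F i) - fps_const (f_sp net i))"
    unfolding residual_def REF_f_eq_def fst_conv snd_conv by (intro has_taylor_intros f i)
  from has_taylor_DT[OF this] show ?thesis
    using k by (simp add: a_F_def unit_row_scalar_prod[OF i] rho_k)
qed

end

section \<open>Assembling the block matrices into one list of entries\<close>

lemma linear_form_eq_vec_of_list:
  "A_gy net E F *\<^sub>v Y_vec net E F k + c \<cdot>\<^sub>v A_gl net + B_g net E F k =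
   vec_of_list (
     interleave (PQ_buses net)
       (\<lambda>i. a_P_bar net E F i \<bullet> Y_vec net E F k + c * - dp net i + eps_bar net E F k i)
       (\<lambda>i. a_Q_bar net E F i \<bullet> Y_vec net E F k + c * - dq net i + mu_bar net E F k i)
   @ interleave (PV_buses net)
       (\<lambda>i. a_P net E F i \<bullet> Y_vec net E F k + c * - dp net i + eps net E F k i)
       (\<lambda>i. a_V net E F i \<bullet> Y_vec net E F k + c * - 0 + sigma_V net E F k i)
   @ interleave [nbus net]
       (\<lambda>i. a_E net i \<bullet> Y_vec net E F k + c * 0 + - e_sp net i * rho k)
       (\<lambda>i. a_F net i \<bullet> Y_vec net E F k + c * 0 + - f_sp net i * rho k))"
proof -
  let ?Y = "Y_vec net E F k" and ?n = "2 * nbus net"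
  have PQ: "A_y_PQ net E F *\<^sub>v ?Y = vec_of_list (interleave (PQ_buses net)
      (\<lambda>i. a_P_bar net E F i \<bullet> ?Y) (\<lambda>i. a_Q_bar net E F i \<bullet> ?Y))"
    unfolding A_y_PQ_def
    by (subst mat_of_rows_mult_vec) (auto simp: set_interleave map_interleave simp del: vec_of_list_map)
  have PV: "A_y_PV net E F *\<^sub>v ?Y = vec_of_list (interleave (PV_buses net)
      (\<lambda>i. a_P net E F i \<bullet> ?Y) (\<lambda>i. a_V net E F i \<bullet> ?Y))"
    unfolding A_y_PV_def
    by (subst mat_of_rows_mult_vec) (auto simp: set_interleave map_interleave simp del: vec_of_list_map)
  have REF: "A_y_REF net *\<^sub>v ?Y = vec_of_list (interleave [nbus net]
      (\<lambda>i. a_E net i \<bullet> ?Y) (\<lambda>i. a_F net i \<bullet> ?Y))"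
    unfolding A_y_REF_def
    by (subst mat_of_rows_mult_vec) (auto simp: a_E_def a_F_def)
  have "A_y_PQ net E F \<in> carrier_mat (2 * length (PQ_buses net)) ?n"
    "A_y_PV net E F \<in> carrier_mat (2 * length (PV_buses net)) ?n"
    "A_y_REF net \<in> carrier_mat 2 ?n"
    by (auto simp: A_y_PQ_def A_y_PV_def A_y_REF_def)
  then have mult: "A_gy net E F *\<^sub>v ?Y = (A_y_PQ net E F *\<^sub>v ?Y) @\<^sub>v (A_y_PV net E F *\<^sub>v ?Y) @\<^sub>v (A_y_REF net *\<^sub>v ?Y)"
    unfolding A_gy_def
    by (metis mat_mult_append carrier_append_rows Y_vec_carrier)
  have smult: "c \<cdot>\<^sub>v (v @\<^sub>v w) = (c \<cdot>\<^sub>v v) @\<^sub>v (c \<cdot>\<^sub>v w)" for v w :: "real vec"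
    by (rule eq_vecI) auto
  \<comment> \<open>The reference block is written as an interleaving over a singleton, so that all
    three blocks have the same shape.\<close>
  have REF_list: "A_l_REF = vec_of_list (interleave [nbus net] (\<lambda>i. 0) (\<lambda>i. 0))"
    "B_REF net k = vec_of_list (interleave [nbus net] (\<lambda>i. - e_sp net i * rho k) (\<lambda>i. - f_sp net i * rho k))"
    by (simp_all add: A_l_REF_def B_REF_def)
  \<comment> \<open>The heads have equal length because both run over the same bus list, so the
    hypothesis concerns the tails.\<close>
  have append_add: "(vec_of_list (interleave is a b) @\<^sub>v v) + (vec_of_list (interleave is a' b') @\<^sub>v w) =
      vec_of_list (interleave is (\<lambda>i. a i + a' i) (\<lambda>i. b i + b' i)) @\<^sub>v (v + w)"
    if "dim_vec v = dim_vec w" for "is" a b a' b' and v w :: "real vec"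
  proof -
    have "vec_of_list (interleave is a b) \<in> carrier_vec (2 * length is)"
      "vec_of_list (interleave is a' b') \<in> carrier_vec (2 * length is)"
      "v \<in> carrier_vec (dim_vec w)" "w \<in> carrier_vec (dim_vec w)"
      using that by (auto intro: carrier_vecI)
    from append_vec_add[OF this] show ?thesis
      by (simp only: vec_of_list_interleave_add)
  qed
  show ?thesis
    unfolding mult A_gl_def B_g_def A_l_PQ_def A_l_PV_def B_PQ_def B_PV_def REF_list PQ PV REF
      smult vec_of_list_append[symmetric]
    by (simp only: vec_of_list_interleave_smult vec_of_list_interleave_uminus
        append_add vec_of_list_interleave_add
        index_append_vec dim_vec_of_list length_interleave)
qed

section \<open>Dependence of the matrices on lower orders\<close>

lemma matrices_cong:
  assumes net: "npq net < nbus net" and "k \<ge> 1"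
    and eq: "\<And>i m. i \<in> {1..nbus net} \<Longrightarrow> m < k \<Longrightarrow> E' i m = E i m \<and> F' i m = F i m"
  shows "A_gy net E' F' = A_gy net E F" "B_g net E' F' k = B_g net E F k"
proof -
  have E0: "E' i 0 = E i 0" "F' i 0 = F i 0" if "i \<in> {1..nbus net}" for i
    using eq[OF that, of 0] \<open>k \<ge> 1\<close> by auto
  \<comment> \<open>For \<open>1 \<le> m < k\<close> both \<open>m\<close> and \<open>k - m\<close>
    lie below \<open>k\<close>, so the convolutions see only coefficients on which the two families
    agree. The matrix \<open>A_gy\<close> involves order 0 alone.\<close>
  have c: "c_conv E' F' k i j = c_conv E F k i j" "d_conv E' F' k i j = d_conv E F k i j"
    if "i \<in> {1..nbus net}" "j \<in> {1..nbus net}" for i j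
    using eq[OF that(1)] eq[OF that(2)] by (simp_all add: c_conv_def d_conv_def)
  have sums: "(\<Sum>h=1..nbus net. gY net i h * E' h 0 - bY net i h * F' h 0) =
      (\<Sum>h=1..nbus net. gY net i h * E h 0 - bY net i h * F h 0)"
    "(\<Sum>h=1..nbus net. bY net i h * E' h 0 + gY net i h * F' h 0) =
      (\<Sum>h=1..nbus net. bY net i h * E h 0 + gY net i h * F h 0)" for i
    by (auto intro!: sum.cong simp: E0)
  have aP: "a_P net E' F' i = a_P net E F i" and aQ: "a_Q net E' F' i = a_Q net E F i"
    and aV: "a_V net E' F' i = a_V net E F i"
    and zip: "a_ZIP net E' F' i = a_ZIP net E F i" "c_ZIP net E' F' i = c_ZIP net E F i"
    if "i \<in> {1..nbus net}" for i
    unfolding a_P_def a_Q_def a_V_def a_ZIP_def c_ZIP_def alpha_P_def beta_P_def phi_Q_def psi_Q_def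
      tau1_def tau2_def tau3_def tau4_def sums E0[OF that] by (rule refl)+
  have aPb: "a_P_bar net E' F' i = a_P_bar net E F i" and aQb: "a_Q_bar net E' F' i = a_Q_bar net E F i"
    if "i \<in> {1..nbus net}" for i
    using that by (simp_all add: a_P_bar_def a_Q_bar_def aP aQ zip)
  have eps: "eps net E' F' k i = eps net E F k i" and mu: "mu net E' F' k i = mu net E F k i"
    and sig: "sigma_V net E' F' k i = sigma_V net E F k i"
    and zipb: "b_ZIP net E' F' k i = b_ZIP net E F k i" "d_ZIP net E' F' k i = d_ZIP net E F k i"
    if "i \<in> {1..nbus net}" for i
    using that by (simp_all add: eps_def mu_def sigma_V_def b_ZIP_def d_ZIP_def c)
  have bar: "eps_bar net E' F' k i = eps_bar net E F k i" "mu_bar net E' F' k i = mu_bar net E F k i"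
    if "i \<in> {1..nbus net}" for i
    using that by (simp_all add: eps_bar_def mu_bar_def eps mu zipb)
  have PQ: "set (PQ_buses net) \<subseteq> {1..nbus net}" and PV: "set (PV_buses net) \<subseteq> {1..nbus net}"
    using net by (auto simp: PQ_buses_def PV_buses_def)
  have "interleave (PQ_buses net) (a_P_bar net E' F') (a_Q_bar net E' F') =
      interleave (PQ_buses net) (a_P_bar net E F) (a_Q_bar net E F)"
    "interleave (PV_buses net) (a_P net E' F') (a_V net E' F') =
      interleave (PV_buses net) (a_P net E F) (a_V net E F)"
    using PQ PV by (auto intro!: interleave_cong simp: aPb aQb aP aV subset_iff)
  then show "A_gy net E' F' = A_gy net E F"
    by (simp add: A_gy_def A_y_PQ_def A_y_PV_def)
  have "interleave (PQ_buses net) (eps_bar net E' F' k) (mu_bar net E' F' k) =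
      interleave (PQ_buses net) (eps_bar net E F k) (mu_bar net E F k)"
    "interleave (PV_buses net) (eps net E' F' k) (sigma_V net E' F' k) =
      interleave (PV_buses net) (eps net E F k) (sigma_V net E F k)"
    using PQ PV by (auto intro!: interleave_cong simp: bar eps sig subset_iff)
  then show "B_g net E' F' k = B_g net E F k"
    by (simp add: B_g_def B_PQ_def B_PV_def)
qed

section \<open>From entries to the vector equation of order \<open>k\<close>\<close>

lemma length_power_flow_eqs:
  "npq net < nbus net \<Longrightarrow> length (power_flow_eqs net e f l) = 2 * nbus net"
  by (simp add: power_flow_eqs_def PQ_buses_def PV_buses_def del: upt_Suc)

lemma zero_vec_eq_vec_of_list_iff: "0\<^sub>v (length xs) = vec_of_list xs \<longleftrightarrow> (\<forall>x\<in>set xs. x = 0)"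
  by (induction xs) (auto simp: zero_vec_Suc)

text \<open>Dependence on orders below \<open>k\<close> is rendered as invariance of
  \<open>A_gy\<close> and \<open>B_g\<close> under any change of the coefficient families that keeps
  these orders at all buses; \<open>A_gl\<close> takes only the network as argument.\<close>

theorem proposition5:
  fixes net :: zip_network
    and e f :: "nat \<Rightarrow> real \<Rightarrow> real"
    and l :: "real \<Rightarrow> real"
    and E F :: "nat \<Rightarrow> nat \<Rightarrow> real"
    and L :: "nat \<Rightarrow> real"
    and k :: nat
  assumes "npq net < nbus net"
    and "\<And>i. i \<in> set (PQ_buses net) \<Longrightarrow> z_sp net i \<noteq> 0"
    and "\<And>i. i \<in> set (PQ_buses net) \<Longrightarrow> alphaZ net i + alphaI net i + alphaP net i = 1"
    and "\<And>i. i \<in> set (PQ_buses net) \<Longrightarrow> betaZ net i + betaI net i + betaP net i = 1"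
    and "\<And>i. i \<in> set (all_buses net) \<Longrightarrow> smooth_near_0 (e i)"
    and "\<And>i. i \<in> set (all_buses net) \<Longrightarrow> smooth_near_0 (f i)"
    and "smooth_near_0 l"
    and "\<And>i m. E i m = DT (e i) m"
    and "\<And>i m. F i m = DT (f i) m"
    and "\<And>m. L m = DT l m"
    and "k \<ge> 1"
  shows "DT_g net e f l k = A_gy net E F *\<^sub>v Y_vec net E F k + L k \<cdot>\<^sub>v A_gl net + B_g net E F k
    \<and> ((\<forall>q \<in> set (power_flow_eqs net e f l). holds_DT q k) \<longleftrightarrow>
           0\<^sub>v (2 * nbus net) = A_gy net E F *\<^sub>v Y_vec net E F k + L k \<cdot>\<^sub>v A_gl net + B_g net E F k)
    \<and> ((\<forall>\<^sub>F t in nhds 0. \<forall>q \<in> set (power_flow_eqs net e f l). holds_at q t) \<longrightarrow>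
           0\<^sub>v (2 * nbus net) = A_gy net E F *\<^sub>v Y_vec net E F k + L k \<cdot>\<^sub>v A_gl net + B_g net E F k)
    \<and> (\<forall>E' F'. (\<forall>i \<in> set (all_buses net). \<forall>m<k. E' i m = E i m \<and> F' i m = F i m) \<longrightarrow>
           A_gy net E' F' = A_gy net E F \<and> B_g net E' F' k = B_g net E F k)"
proof -
  let ?R = "A_gy net E F *\<^sub>v Y_vec net E F k + L k \<cdot>\<^sub>v A_gl net + B_g net E F k"
  let ?eqs = "power_flow_eqs net e f l"
  have fps: "Abs_fps (E i) = Abs_fps (DT (e i))" "Abs_fps (F i) = Abs_fps (DT (f i))"
    "Abs_fps L = Abs_fps (DT l)" for i
    using assms(8-10) by (simp_all add: fps_eq_iff)
  have e: "has_taylor (e i) (Abs_fps (E i))" and f: "has_taylor (f i) (Abs_fps (F i))"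
    if "i \<in> {1..nbus net}" for i
    using that assms(5,6) by (simp_all add: set_all_buses fps smooth_near_0_imp_has_taylor)
  have l: "has_taylor l (Abs_fps L)"
    using assms(7) by (simp add: fps smooth_near_0_imp_has_taylor)
  note taylor = e f l \<open>k \<ge> 1\<close>
  have PQ: "i \<in> {1..nbus net}" if "i \<in> set (PQ_buses net)" for i
    using that assms(1) by (auto simp: PQ_buses_def)
  have PV: "i \<in> {1..nbus net}" if "i \<in> set (PV_buses net)" for i
    using that assms(1) by (auto simp: PV_buses_def)
  have REF: "i \<in> {1..nbus net}" if "i \<in> set [nbus net]" for i
    using that assms(1) by auto
  have eqs: "?eqs = interleave (PQ_buses net) (PQ_p_eq net e f l) (PQ_q_eq net e f l)
      @ interleave (PV_buses net) (PV_p_eq net e f l) (PV_v_eq net e f)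
      @ interleave [nbus net] (REF_e_eq net e) (REF_f_eq net f)"
    by (simp add: power_flow_eqs_def)
  \<comment> \<open>Each note is an equation between interleaved lists; \<open>PQ\<close>,
    \<open>PV\<close> and \<open>REF\<close> turn membership in the bus list into the range
    condition of the row lemmas.\<close>
  note PQ_rows = interleave_cong[OF DT_residual_PQ_p[OF taylor PQ] DT_residual_PQ_q[OF taylor PQ]]
  note PV_rows = interleave_cong[OF DT_residual_PV_p[OF taylor PV] DT_residual_PV_v[OF taylor PV]]
  note REF_rows = interleave_cong[OF DT_residual_REF_e[OF taylor REF] DT_residual_REF_f[OF taylor REF]]
  have DT_g: "DT_g net e f l k = ?R"
    unfolding DT_g_def eqs map_append map_interleave linear_form_eq_vec_of_list
    by (simp only: PQ_rows PV_rows REF_rows)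
  \<comment> \<open>The series of the residual is the difference of the series of the two sides, so
    it vanishes at order \<open>k\<close> exactly if their coefficients agree.\<close>
  have DT_iff: "DT (residual q) k = 0 \<longleftrightarrow> holds_DT q k" if "q \<in> set ?eqs" for q
  proof -
    obtain P Q where PQ: "has_taylor (fst q) P" "has_taylor (snd q) Q"
      using has_taylor_power_flow_eqs[OF taylor assms(1) \<open>q \<in> set ?eqs\<close>] by blast
    then have "has_taylor (residual q) (Q - P)"
      unfolding residual_def by (intro has_taylor_diff)
    with PQ show ?thesis
      by (auto simp: holds_DT_def has_taylor_DT)
  qed
  have "0\<^sub>v (2 * nbus net) = ?R \<longleftrightarrow> (\<forall>x\<in>set (map (\<lambda>q. DT (residual q) k) ?eqs). x = 0)"
    using zero_vec_eq_vec_of_list_iff[of "map (\<lambda>q. DT (residual q) k) ?eqs"]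
    by (simp only: DT_g_def length_map length_power_flow_eqs[OF assms(1)] flip: DT_g)
  also have "\<dots> \<longleftrightarrow> (\<forall>q\<in>set ?eqs. holds_DT q k)"
    using DT_iff by simp
  finally have iff: "(\<forall>q\<in>set ?eqs. holds_DT q k) \<longleftrightarrow> 0\<^sub>v (2 * nbus net) = ?R" by blast
  have "holds_DT q k" if "\<forall>\<^sub>F t in nhds 0. \<forall>q\<in>set ?eqs. holds_at q t" "q \<in> set ?eqs" for q
  proof -
    obtain P where P: "has_taylor (fst q) P"
      using has_taylor_power_flow_eqs[OF taylor assms(1) \<open>q \<in> set ?eqs\<close>] by blast
    have "\<forall>\<^sub>F t in nhds 0. fst q t = snd q t"
      using that(1) by eventually_elim (use that(2) in \<open>auto simp: holds_at_def\<close>)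
    \<comment> \<open>Both sides now have the same series \<open>P\<close>, hence equal
      transforms.\<close>
    from has_taylor_cong[OF P this] P show ?thesis
      by (simp add: holds_DT_def has_taylor_DT)
  qed
  moreover have "A_gy net E' F' = A_gy net E F \<and> B_g net E' F' k = B_g net E F k"
    if "\<forall>i\<in>set (all_buses net). \<forall>m<k. E' i m = E i m \<and> F' i m = F i m" for E' F'
    using matrices_cong[OF assms(1) \<open>k \<ge> 1\<close>, of E' E F' F] that by (simp add: set_all_buses)
  ultimately show ?thesis
    using DT_g iff by blast
qed

end
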